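(* Let $\mathfrak f$ be a saturated Frobenius subalgebra of $\mathfrak{sl}_n(\mathbb C)$, $n\ge 2$. Then the eigenvalues of $\operatorname{ad}\widehat F:\mathfrak f\to\mathfrak f$, together with their multiplicities, depend only on $\mathfrak f$ and not on the choice of Frobenius functional $F$; that is, if $F,F'\in\mathfrak f^*$ are any two Frobenius functionals with principal elements $\widehat F,\widehat F'\in\mathfrak f$, then $\operatorname{ad}\widehat F$ and $\operatorname{ad}\widehat F'$ have the same eigenvalues on $\mathfrak f$ with the same multiplicities.
   Context: All Lie algebras are finite-dimensional over $\mathbb C$. For a Lie algebra $\mathfrak f$ and $F\in\mathfrak f^*$, let $B_F(x,y)=F([x,y])$, a skew-symmetric bilinear form on $\mathfrak f$. $F$ is a Frobenius functional if $B_F$ is non-degenerate, and $\mathfrak f$ is Frobenius if it has a Frobenius functional. If $F$ is a Frobenius functional, the principal element of $F$ is the unique $\widehat F\in\mathfrak f$ such that $F(x)=F([\widehat F,x])$ for all $x\in\mathfrak f$. A Frobenius subalgebra $\mathfrak f$ of a simple Lie algebra $\mathfrak g$ is saturated if $\mathfrak f$ is not an ideal of any strictly larger subalgebra of $\mathfrak g$. *)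

theory Defs
  imports "HOL-Analysis.Analysis"
begin

definition cmat_scale :: "complex \<Rightarrow> complex^'n^'n \<Rightarrow> complex^'n^'n" (infixr \<open>*\<^sub>M\<close> 75)
  where "c *\<^sub>M A = (\<chi> i j. c * A $ i $ j)"

lemma cmat_scale_nth [simp]: "(c *\<^sub>M A) $ i $ j = c * A $ i $ j"
  by (simp add: cmat_scale_def)

definition matrix_unit :: "'n \<times> 'n \<Rightarrow> complex^'n^'n"
  where "matrix_unit p = (\<chi> i j. if (i, j) = p then 1 else 0)"

lemma matrix_unit_nth [simp]: "matrix_unit p $ i $ j = (if (i, j) = p then 1 else 0)"
  by (simp add: matrix_unit_def)

interpretation cmat: vector_space cmat_scale
  by unfold_locales (simp_all add: vec_eq_iff algebra_simps)

lemma cmat_eq_sum_units: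
  fixes A :: "complex^'n^'n"
  shows "A = (\<Sum>p\<in>UNIV. (A $ fst p $ snd p) *\<^sub>M matrix_unit p)"
proof -
  have "(\<Sum>p\<in>UNIV. (A $ fst p $ snd p) *\<^sub>M matrix_unit p) $ i $ j = A $ i $ j" for i j
  proof -
    have "(\<Sum>p\<in>UNIV. (A $ fst p $ snd p) *\<^sub>M matrix_unit p) $ i $ j
        = (\<Sum>p\<in>UNIV. if p = (i, j) then A $ i $ j else 0)"
      unfolding sum_component by (rule sum.cong) auto
    then show ?thesis by simp
  qed
  then show ?thesis by (simp add: vec_eq_iff)
qed

lemma inj_matrix_unit: "inj matrix_unit"
proof (rule injI)
  fix p q :: "'n::finite \<times> 'n"
  assume "matrix_unit p = matrix_unit q"
  then have "matrix_unit p $ fst p $ snd p = matrix_unit q $ fst p $ snd p" by simp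
  then show "p = q" by (simp split: if_splits)
qed

lemma independent_matrix_units: "cmat.independent (range (matrix_unit :: 'n \<times> 'n \<Rightarrow> complex^'n^'n))"
proof (rule cmat.independent_if_scalars_zero)
  show "finite (range (matrix_unit :: 'n \<times> 'n \<Rightarrow> complex^'n^'n))" by simp
  fix f :: "complex^'n^'n \<Rightarrow> complex" and x :: "complex^'n^'n"
  assume f: "(\<Sum>x\<in>range matrix_unit. f x *\<^sub>M x) = 0" and "x \<in> range matrix_unit"
  then obtain i j where x: "x = matrix_unit (i, j)" by auto
  have "0 = (\<Sum>p\<in>UNIV. f (matrix_unit p) *\<^sub>M matrix_unit p) $ i $ j"
    using f by (simp add: sum.reindex[OF inj_matrix_unit])
  also have "\<dots> = (\<Sum>p\<in>UNIV. if p = (i, j) then f (matrix_unit (i, j)) else 0)"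
    unfolding sum_component by (rule sum.cong) auto
  finally show "f x = 0" by (simp add: x)
qed

lemma span_matrix_units: "cmat.span (range matrix_unit) = UNIV"
proof (intro equalityI subset_UNIV subsetI)
  fix A :: "complex^'n^'n"
  show "A \<in> cmat.span (range matrix_unit)"
    by (subst cmat_eq_sum_units) (intro cmat.span_sum cmat.span_scale cmat.span_base rangeI)
qed

interpretation cmat: finite_dimensional_vector_space cmat_scale "range matrix_unit"
  by unfold_locales (simp_all add: independent_matrix_units span_matrix_units)

definition lie_bracket :: "complex^'n^'n \<Rightarrow> complex^'n^'n \<Rightarrow> complex^'n^'n"
  where "lie_bracket X Y = X ** Y - Y ** X"

definition sl :: "(complex^'n^'n) set"
  where "sl = {A. trace A = 0}"

definition lie_subalgebra :: "(complex^'n^'n) set \<Rightarrow> (complex^'n^'n) set \<Rightarrow> bool"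
  where "lie_subalgebra L G \<longleftrightarrow>
    L \<subseteq> G \<and> cmat.subspace L \<and> (\<forall>x\<in>L. \<forall>y\<in>L. lie_bracket x y \<in> L)"

definition lie_ideal :: "(complex^'n^'n) set \<Rightarrow> (complex^'n^'n) set \<Rightarrow> bool"
  where "lie_ideal L H \<longleftrightarrow>
    L \<subseteq> H \<and> cmat.subspace L \<and> (\<forall>h\<in>H. \<forall>x\<in>L. lie_bracket h x \<in> L)"

definition saturated :: "(complex^'n^'n) set \<Rightarrow> (complex^'n^'n) set \<Rightarrow> bool"
  where "saturated L G \<longleftrightarrow>
    (\<forall>H. lie_subalgebra H G \<and> L \<subset> H \<longrightarrow> \<not> lie_ideal L H)"

text \<open>An element of the dual of \<open>L\<close> is represented by a function on all matrices that is linear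
  on \<open>L\<close>; its values outside \<open>L\<close> are irrelevant.\<close>

definition dual_element :: "(complex^'n^'n) set \<Rightarrow> (complex^'n^'n \<Rightarrow> complex) \<Rightarrow> bool"
  where "dual_element L F \<longleftrightarrow>
    (\<forall>x\<in>L. \<forall>y\<in>L. F (x + y) = F x + F y) \<and> (\<forall>c. \<forall>x\<in>L. F (c *\<^sub>M x) = c * F x)"

definition bracket_form ::
    "(complex^'n^'n \<Rightarrow> complex) \<Rightarrow> complex^'n^'n \<Rightarrow> complex^'n^'n \<Rightarrow> complex"
  where "bracket_form F x y = F (lie_bracket x y)"

definition frobenius_functional :: "(complex^'n^'n) set \<Rightarrow> (complex^'n^'n \<Rightarrow> complex) \<Rightarrow> bool"
  where "frobenius_functional L F \<longleftrightarrow>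
    dual_element L F \<and> (\<forall>x\<in>L. (\<forall>y\<in>L. bracket_form F x y = 0) \<longrightarrow> x = 0)"

definition frobenius :: "(complex^'n^'n) set \<Rightarrow> bool"
  where "frobenius L \<longleftrightarrow> (\<exists>F. frobenius_functional L F)"

text \<open>Well-defined for Frobenius functionals by \<open>principal_element_ex1\<close> below.\<close>

definition principal_element ::
    "(complex^'n^'n) set \<Rightarrow> (complex^'n^'n \<Rightarrow> complex) \<Rightarrow> complex^'n^'n"
  where "principal_element L F = (THE h. h \<in> L \<and> (\<forall>x\<in>L. F x = F (lie_bracket h x)))"

lemma lie_bracket_add_left: "lie_bracket (x + y) z = lie_bracket x z + lie_bracket y z"
  by (simp add: lie_bracket_def vec_eq_iff matrix_matrix_mult_def sum.distrib algebra_simps)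

lemma lie_bracket_add_right: "lie_bracket z (x + y) = lie_bracket z x + lie_bracket z y"
  by (simp add: lie_bracket_def vec_eq_iff matrix_matrix_mult_def sum.distrib algebra_simps)

lemma lie_bracket_scale_left: "lie_bracket (c *\<^sub>M x) y = c *\<^sub>M lie_bracket x y"
  by (simp add: lie_bracket_def vec_eq_iff matrix_matrix_mult_def sum_distrib_left algebra_simps)

lemma lie_bracket_scale_right: "lie_bracket x (c *\<^sub>M y) = c *\<^sub>M lie_bracket x y"
  by (simp add: lie_bracket_def vec_eq_iff matrix_matrix_mult_def sum_distrib_left algebra_simps)

lemma dual_element_eqI:
  assumes L: "cmat.subspace L" and B: "B \<subseteq> L" "L \<subseteq> cmat.span B"
    and F: "dual_element L F" and G: "dual_element L G" and eq: "\<And>b. b \<in> B \<Longrightarrow> F b = G b"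
    and x: "x \<in> L"
  shows "F x = G x"
proof -
  have "x \<in> cmat.span B" using B x by auto
  then have "x \<in> L \<and> F x = G x"
  proof (induction rule: cmat.span_induct_alt)
    case base
    have "F 0 = 0" "G 0 = 0"
      using F G cmat.subspace_0[OF L] unfolding dual_element_def
      by (metis cmat.scale_zero_left mult_zero_left)+
    then show ?case using cmat.subspace_0[OF L] by simp
  next
    case (step c b y)
    then have "b \<in> L" "c *\<^sub>M b \<in> L" using B cmat.subspace_scale[OF L] by auto
    with step show ?case using F G eq cmat.subspace_add[OF L]
      unfolding dual_element_def by simp
  qed
  then show ?thesis ..
qed

lemma principal_element_ex1:
  assumes L: "lie_subalgebra L G" and F: "frobenius_functional L F"
  shows "\<exists>!h. h \<in> L \<and> (\<forall>x\<in>L. F x = F (lie_bracket h x))"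
proof -
  have sub: "cmat.subspace L" and br: "\<And>x y. x \<in> L \<Longrightarrow> y \<in> L \<Longrightarrow> lie_bracket x y \<in> L"
    using L by (auto simp: lie_subalgebra_def)
  have dual: "dual_element L F" using F by (simp add: frobenius_functional_def)
  have add: "F (x + y) = F x + F y" if "x \<in> L" "y \<in> L" for x y
    using dual that by (auto simp: dual_element_def)
  have scale: "F (c *\<^sub>M x) = c * F x" if "x \<in> L" for c x
    using dual that by (auto simp: dual_element_def)
  have diff: "F (x - y) = F x - F y" if "x \<in> L" "y \<in> L" for x y
    using add[of "x - y" y] that cmat.subspace_diff[OF sub] by simp
  have nondeg: "x = 0" if "x \<in> L" "\<And>y. y \<in> L \<Longrightarrow> F (lie_bracket x y) = 0" for x
    using F that by (auto simp: frobenius_functional_def bracket_form_def)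
  have br_diff: "lie_bracket (x - y) z = lie_bracket x z - lie_bracket y z" for x y z :: "complex^'a^'a"
    using lie_bracket_add_left[of "x - y" y z] by simp
  have dual_br: "dual_element L (\<lambda>y. F (lie_bracket x y))" if "x \<in> L" for x
    unfolding dual_element_def
    using that br add scale by (simp add: lie_bracket_add_right lie_bracket_scale_right)
  obtain B where B: "B \<subseteq> L" "cmat.independent B" "L \<subseteq> cmat.span B"
    using cmat.basis_exists by metis
  have spanB: "cmat.span B = L"
    using B sub by (simp add: cmat.span_minimal subset_antisym)
  have finB: "finite B" using B(2) cmat.finiteI_independent by blast
  interpret P: finite_dimensional_vector_space_pair cmat_scale "range matrix_unit"
      cmat_scale "range (matrix_unit :: 'a \<times> 'a \<Rightarrow> _)" ..
  define \<phi> where "\<phi> x = (\<Sum>b\<in>B. F (lie_bracket x b) *\<^sub>M b)" for x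
  obtain g where g: "Vector_Spaces.linear cmat_scale cmat_scale g" "\<And>b. b \<in> B \<Longrightarrow> g b = \<phi> b"
    using P.linear_independent_extend[OF B(2)] by metis
  interpret g: Vector_Spaces.linear cmat_scale cmat_scale g by (rule g(1))
  have g_eq: "g x = \<phi> x" if "x \<in> L" for x
  proof -
    have "x \<in> cmat.span B" using B that by auto
    then have "x \<in> L \<and> g x = \<phi> x"
    proof (induction rule: cmat.span_induct_alt)
      case base
      have "F (lie_bracket 0 b) = 0" if "b \<in> B" for b
        using that B(1) br[of 0 b] scale[of 0 0] cmat.subspace_0[OF sub]
        by (simp add: lie_bracket_def)
      then show ?case using cmat.subspace_0[OF sub] by (simp add: \<phi>_def)
    next
      case (step c b y)
      then have bL: "b \<in> L" "c *\<^sub>M b \<in> L" using B cmat.subspace_scale[OF sub] by auto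
      have BL: "\<And>b. b \<in> B \<Longrightarrow> b \<in> L" using B by auto
      have "F (lie_bracket (c *\<^sub>M b + y) b') = c * F (lie_bracket b b') + F (lie_bracket y b')"
        if "b' \<in> B" for b'
      proof -
        have "lie_bracket b b' \<in> L" "lie_bracket y b' \<in> L"
          using br bL step BL that by auto
        then show ?thesis
          by (simp add: lie_bracket_add_left lie_bracket_scale_left add scale
              cmat.subspace_scale[OF sub])
      qed
      then have "\<phi> (c *\<^sub>M b + y) = c *\<^sub>M \<phi> b + \<phi> y"
        by (simp add: \<phi>_def cmat.scale_left_distrib sum.distrib cmat.scale_sum_right)
      then show ?case
        using step bL g(2) cmat.subspace_add[OF sub] by (simp add: g.add g.scale)
    qed
    then show ?thesis ..
  qed
  have zero_br: "F (lie_bracket x y) = 0" if x: "x \<in> L" and "g x = 0" and y: "y \<in> L" for x y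
  proof -
    have "(\<Sum>b\<in>B. F (lie_bracket x b) *\<^sub>M b) = 0"
      using \<open>g x = 0\<close> g_eq[OF x] by (simp add: \<phi>_def)
    then have "F (lie_bracket x b) = 0" if "b \<in> B" for b
      using cmat.independentD[OF B(2) finB subset_refl, of "\<lambda>b. F (lie_bracket x b)"] that by simp
    then show ?thesis
      using dual_element_eqI[OF sub B(1,3) dual_br[OF x], of "\<lambda>_. 0" y] y
      by (simp add: dual_element_def)
  qed
  have "inj_on g L"
    unfolding g.inj_on_iff_eq_0[OF sub] using zero_br nondeg by blast
  then have inj: "inj_on g (cmat.span L)"
    by (simp only: cmat.span_eq_iff[THEN iffD2, OF sub])
  have "g ` L \<subseteq> L"
  proof
    fix z assume "z \<in> g ` L"
    then obtain x where "x \<in> L" "z = \<phi> x" using g_eq by auto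
    then have "z \<in> cmat.span B"
      unfolding \<phi>_def by (auto intro: cmat.span_sum cmat.span_scale cmat.span_base)
    then show "z \<in> L" using spanB by simp
  qed
  moreover have "cmat.dim (g ` L) = cmat.dim L"
    using P.dim_image_eq[OF g(1) inj] .
  ultimately have surj: "g ` L = L"
    using cmat.subspace_dim_equal[OF g.subspace_image[OF sub] sub] by simp
  have "(\<Sum>b\<in>B. F b *\<^sub>M b) \<in> L"
    unfolding spanB[symmetric] by (intro cmat.span_sum cmat.span_scale cmat.span_base)
  then have "(\<Sum>b\<in>B. F b *\<^sub>M b) \<in> g ` L"
    by (simp only: surj)
  then obtain h where h: "h \<in> L" "g h = (\<Sum>b\<in>B. F b *\<^sub>M b)"
    by (elim imageE) simp
  have "(\<Sum>b\<in>B. (F (lie_bracket h b) - F b) *\<^sub>M b) = 0"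
    using h g_eq[OF h(1)] by (simp add: \<phi>_def cmat.scale_left_diff_distrib sum_subtractf)
  then have "F (lie_bracket h b) - F b = 0" if "b \<in> B" for b
    using cmat.independentD[OF B(2) finB subset_refl, of "\<lambda>b. F (lie_bracket h b) - F b"] that by simp
  then have "F x = F (lie_bracket h x)" if "x \<in> L" for x
    using dual_element_eqI[OF sub B(1,3) dual dual_br[OF h(1)] _ that] by simp
  moreover have "h' = h''"
    if mem: "h' \<in> L" "h'' \<in> L"
      and eq: "\<forall>x\<in>L. F x = F (lie_bracket h' x)" "\<forall>x\<in>L. F x = F (lie_bracket h'' x)"
    for h' h''
  proof -
    have "F (lie_bracket (h' - h'') y) = 0" if y: "y \<in> L" for y
    proof -
      have "F (lie_bracket h' y) = F (lie_bracket h'' y)"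
        using bspec[OF eq(1) y] bspec[OF eq(2) y] by (rule trans[OF sym])
      then show ?thesis
        using br[OF \<open>h' \<in> L\<close> y] br[OF \<open>h'' \<in> L\<close> y] by (simp add: br_diff diff)
    qed
    then have "h' - h'' = 0"
      using nondeg cmat.subspace_diff[OF sub mem] by blast
    then show ?thesis by simp
  qed
  ultimately show ?thesis using h(1) by blast
qed

definition ad_eigenvalues :: "(complex^'n^'n) set \<Rightarrow> complex^'n^'n \<Rightarrow> complex set"
  where "ad_eigenvalues L h = {\<mu>. \<exists>y\<in>L. y \<noteq> 0 \<and> lie_bracket h y = \<mu> *\<^sub>M y}"

definition ad_generalized_eigenspace ::
    "(complex^'n^'n) set \<Rightarrow> complex^'n^'n \<Rightarrow> complex \<Rightarrow> (complex^'n^'n) set"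
  where "ad_generalized_eigenspace L h \<mu> =
    {y \<in> L. \<exists>k. ((\<lambda>z. lie_bracket h z - \<mu> *\<^sub>M z) ^^ k) y = 0}"

text \<open>Algebraic multiplicity, as the complex dimension of the generalized eigenspace.\<close>

definition ad_multiplicity :: "(complex^'n^'n) set \<Rightarrow> complex^'n^'n \<Rightarrow> complex \<Rightarrow> nat"
  where "ad_multiplicity L h \<mu> = cmat.dim (ad_generalized_eigenspace L h \<mu>)"

end

theory Submission
  imports Defs "HOL-Complex_Analysis.Conformal_Mappings"
begin

text \<open>All Frobenius functionals on a Frobenius Lie algebra \<open>L\<close> lie on a single coadjoint orbit, so
  any two principal elements are conjugate under an automorphism of \<open>L\<close>. Non-degeneracy of
  \<open>B\<^sub>F\<close> says that the derivative at \<open>0\<close> of \<open>x \<mapsto> F \<circ> exp (ad x)\<close>, \<open>x \<in> L\<close>, is onto the dual of \<open>L\<close>, so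
  the orbit of \<open>F\<close> is a neighbourhood of \<open>F\<close>. On the complex line \<open>(1 - t) F + t F'\<close> the degenerate
  functionals are the zeros of a determinant that is holomorphic in \<open>t\<close> and nonzero at \<open>0\<close>; deleting
  countably many points from the plane leaves a connected set, on which the spectrum of the
  principal element is locally constant.\<close>

section \<open>Real normed structure on complex matrices: linear maps are bounded, products and
  brackets are bounded bilinear\<close>

lemma scaleR_eq_cmat_scale: "r *\<^sub>R (A :: complex^'n^'n) = of_real r *\<^sub>M A"
  by (simp add: vec_eq_iff) (simp add: scaleR_conv_of_real)

lemma subspace_if_cmat_subspace:
  fixes S :: "(complex^'n^'n) set"
  assumes "cmat.subspace S"
  shows "subspace S"
  using assms cmat.subspace_0 cmat.subspace_add cmat.subspace_scale
  by (auto simp: subspace_def scaleR_eq_cmat_scale)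

lemma bounded_linear_if_additive_homogeneous:
  fixes f :: "complex^'n^'n \<Rightarrow> 'b::real_normed_vector"
  assumes "\<And>x y. f (x + y) = f x + f y"
    and "\<And>r x. f (of_real r *\<^sub>M x) = r *\<^sub>R f x"
  shows "bounded_linear f"
  using assms by (auto simp: linear_conv_bounded_linear[symmetric] scaleR_eq_cmat_scale intro!: linearI)

lemma bounded_linear_cmat_scale: "bounded_linear (\<lambda>x. c *\<^sub>M x)"
  by (rule bounded_linear_if_additive_homogeneous)
    (simp_all add: scaleR_eq_cmat_scale cmat.scale_right_distrib mult.commute)

interpretation cmat_mult: bounded_bilinear "(**) :: complex^'n^'n \<Rightarrow> complex^'n^'n \<Rightarrow> complex^'n^'n"
  unfolding bilinear_conv_bounded_bilinear[symmetric]
  by (auto simp: bilinear_def linear_iff vec_eq_iff matrix_matrix_mult_def sum.distrib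
      algebra_simps scaleR_sum_right)

interpretation lie_bracket: bounded_bilinear lie_bracket
  unfolding bilinear_conv_bounded_bilinear[symmetric]
  by (auto simp: bilinear_def linear_iff lie_bracket_add_left lie_bracket_add_right
      scaleR_eq_cmat_scale lie_bracket_scale_left lie_bracket_scale_right)

text \<open>\<open>lie_bracket x\<close> is a derivation of the associative product as well; its
  exponential is therefore multiplicative for \<open>**\<close>, which is easier to show than for
  brackets.\<close>

lemma lie_bracket_matrix_mult: "lie_bracket x (y ** z) = lie_bracket x y ** z + y ** lie_bracket x z"
  by (simp add: lie_bracket_def matrix_mul_assoc cmat_mult.diff_left cmat_mult.diff_right)

subsection \<open>The exponential of an inner derivation\<close>

text \<open>The series of \<open>exp (ad x)\<close> is taken on a vector rather than among
  operators, so that only the norm of matrices enters.\<close>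

definition lie_exp_term :: "complex^'n^'n \<Rightarrow> complex^'n^'n \<Rightarrow> nat \<Rightarrow> complex^'n^'n"
  where "lie_exp_term x y k = (1 / fact k) *\<^sub>R (lie_bracket x ^^ k) y"

definition lie_exp :: "complex^'n^'n \<Rightarrow> complex^'n^'n \<Rightarrow> complex^'n^'n"
  where "lie_exp x y = (\<Sum>k. lie_exp_term x y k)"

lemma lie_exp_term_0 [simp]: "lie_exp_term x y 0 = y"
  by (simp add: lie_exp_term_def)

lemma lie_bracket_lie_exp_term:
  "lie_bracket x (lie_exp_term x y k) = real (Suc k) *\<^sub>R lie_exp_term x y (Suc k)"
  by (simp add: lie_exp_term_def lie_bracket.scaleR_right del: of_nat_Suc)

lemma lie_exp_term_Suc:
  "lie_exp_term x y (Suc k) = (1 / real (Suc k)) *\<^sub>R lie_bracket x (lie_exp_term x y k)"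
  by (simp add: lie_bracket_lie_exp_term del: of_nat_Suc)

text \<open>Each application of \<open>lie_bracket x\<close> costs a factor
  \<open>K * norm x\<close>. The resulting exponential majorant serves for summability, for uniform
  convergence and for the derivative at 0.\<close>

lemma norm_lie_exp_term_le:
  assumes K: "\<And>x y :: complex^'n^'n. norm (lie_bracket x y) \<le> norm x * norm y * K" and "K \<ge> 0"
  shows "norm (lie_exp_term x (y :: complex^'n^'n) k) \<le> (K * norm x) ^ k / fact k * norm y"
proof (induction k)
  case (Suc k)
  have "norm (lie_exp_term x y (Suc k)) = norm (lie_bracket x (lie_exp_term x y k)) / real (Suc k)"
    by (simp add: lie_exp_term_Suc del: of_nat_Suc)
  also have "\<dots> \<le> norm x * norm (lie_exp_term x y k) * K / real (Suc k)"
    by (intro divide_right_mono K) simp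
  also have "\<dots> \<le> norm x * ((K * norm x) ^ k / fact k * norm y) * K / real (Suc k)"
    by (intro divide_right_mono mult_right_mono mult_left_mono Suc) (simp_all add: \<open>K \<ge> 0\<close>)
  finally show ?case by (simp add: algebra_simps)
qed simp

lemma summable_norm_lie_exp_term: "summable (\<lambda>k. norm (lie_exp_term x y k))"
proof -
  obtain K where K: "K > 0" "\<And>x y :: complex^'a^'a. norm (lie_bracket x y) \<le> norm x * norm y * K"
    using lie_bracket.pos_bounded by blast
  have "summable (\<lambda>k. (K * norm x) ^ k / fact k * norm y)"
    using summable_exp[of "K * norm x"] by (intro summable_mult2) (simp add: field_simps)
  then show ?thesis
    by (rule summable_comparison_test'[where N = 0])
      (use norm_lie_exp_term_le[of K x y] K in simp)
qed

lemma summable_lie_exp_term: "summable (lie_exp_term x y)"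
  by (rule summable_norm_cancel[OF summable_norm_lie_exp_term])

lemma lie_exp_term_add: "lie_exp_term x (y + z) k = lie_exp_term x y k + lie_exp_term x z k"
  by (induction k)
    (simp_all add: lie_exp_term_Suc lie_bracket_add_right scaleR_add_right del: of_nat_Suc)

lemma lie_exp_term_scale: "lie_exp_term x (c *\<^sub>M y) k = c *\<^sub>M lie_exp_term x y k"
  by (induction k)
    (simp_all add: lie_exp_term_Suc lie_bracket_scale_right scaleR_eq_cmat_scale mult.commute del: of_nat_Suc)

lemma lie_exp_linear: "Vector_Spaces.linear cmat_scale cmat_scale (lie_exp x)"
proof -
  have "lie_exp x (c *\<^sub>M y) = c *\<^sub>M lie_exp x y" for c y
    unfolding lie_exp_def lie_exp_term_scale
    using bounded_linear.suminf[OF bounded_linear_cmat_scale summable_lie_exp_term[of x y], of c]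
    by simp
  moreover have "lie_exp x (y + z) = lie_exp x y + lie_exp x z" for y z
    by (simp add: lie_exp_def lie_exp_term_add suminf_add[OF summable_lie_exp_term summable_lie_exp_term])
  ultimately show ?thesis
    by (simp add: Vector_Spaces.linear_iff cmat.vector_space_axioms)
qed

text \<open>The Leibniz rule for a derivation, with the binomial coefficients absorbed by the
  factorials.\<close>

lemma lie_exp_term_matrix_mult:
  "lie_exp_term x (y ** z) k = (\<Sum>i\<le>k. lie_exp_term x y i ** lie_exp_term x z (k - i))"
proof (induction k)
  case (Suc k)
  let ?a = "lie_exp_term x y" and ?b = "lie_exp_term x z"
  have "real (Suc k) *\<^sub>R lie_exp_term x (y ** z) (Suc k)
      = lie_bracket x (\<Sum>i\<le>k. ?a i ** ?b (k - i))"
    by (simp only: lie_bracket_lie_exp_term[symmetric] Suc)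
  also have "\<dots> = (\<Sum>i\<le>k. real (Suc i) *\<^sub>R (?a (Suc i) ** ?b (k - i)))
      + (\<Sum>i\<le>k. real (Suc (k - i)) *\<^sub>R (?a i ** ?b (Suc (k - i))))"
    by (simp add: lie_bracket.sum_right lie_bracket_matrix_mult lie_bracket_lie_exp_term sum.distrib
        cmat_mult.scaleR_left cmat_mult.scaleR_right del: of_nat_Suc)
  \<comment> \<open>Index shift; the added term \<open>i = 0\<close> has weight 0.\<close>
  also have "(\<Sum>i\<le>k. real (Suc i) *\<^sub>R (?a (Suc i) ** ?b (k - i)))
      = (\<Sum>i\<le>Suc k. real i *\<^sub>R (?a i ** ?b (Suc k - i)))"
    by (simp add: sum.atMost_Suc_shift del: sum.atMost_Suc)
  \<comment> \<open>The added term \<open>i = Suc k\<close> has weight 0, so both sums now run over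
    the same range and their weights add up to \<open>Suc k\<close>.\<close>
  also have "(\<Sum>i\<le>k. real (Suc (k - i)) *\<^sub>R (?a i ** ?b (Suc (k - i))))
      = (\<Sum>i\<le>Suc k. real (Suc k - i) *\<^sub>R (?a i ** ?b (Suc k - i)))"
    by (simp add: Suc_diff_le of_nat_diff algebra_simps)
  also have "(\<Sum>i\<le>Suc k. real i *\<^sub>R (?a i ** ?b (Suc k - i)))
      + (\<Sum>i\<le>Suc k. real (Suc k - i) *\<^sub>R (?a i ** ?b (Suc k - i)))
      = real (Suc k) *\<^sub>R (\<Sum>i\<le>Suc k. ?a i ** ?b (Suc k - i))"
    unfolding sum.distrib[symmetric] scaleR_sum_right
    by (rule sum.cong[OF refl]) (simp add: scaleR_add_left[symmetric] of_nat_diff del: of_nat_Suc)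
  finally show ?case
    by (simp del: of_nat_Suc sum.atMost_Suc)
qed simp

text \<open>The Leibniz rule makes the left side a Cauchy product. It is evaluated entry by entry,
  where the factors are absolutely convergent complex series.\<close>

lemma lie_exp_matrix_mult: "lie_exp x (y ** z) = lie_exp x y ** lie_exp x z"
proof -
  let ?a = "lie_exp_term x y" and ?b = "lie_exp_term x z"
  have entry: "(\<lambda>k. f k $ i $ j) sums (suminf f $ i $ j)" if "summable f"
    for f :: "nat \<Rightarrow> complex^'a^'a" and i j
    using that by (intro bounded_linear.sums[OF bounded_linear_vec_nth] summable_sums)
  have abs: "summable (\<lambda>k. norm (lie_exp_term x u k $ i $ j))" for u i j
    by (rule summable_comparison_test'[OF summable_norm_lie_exp_term[of x u], where N = 0])
      (simp, meson Finite_Cartesian_Product.norm_nth_le order_trans)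
  have "lie_exp x (y ** z) $ i $ j = (lie_exp x y ** lie_exp x z) $ i $ j" for i j
  proof -
    have "(\<lambda>k. \<Sum>l\<in>UNIV. \<Sum>m\<le>k. ?a m $ i $ l * ?b (k - m) $ l $ j) sums
        (\<Sum>l\<in>UNIV. (\<Sum>k. ?a k $ i $ l) * (\<Sum>k. ?b k $ l $ j))"
      by (intro sums_sum Cauchy_product_sums abs)
    moreover have "(\<Sum>l\<in>UNIV. \<Sum>m\<le>k. ?a m $ i $ l * ?b (k - m) $ l $ j)
        = lie_exp_term x (y ** z) k $ i $ j" for k
      unfolding lie_exp_term_matrix_mult
      by (subst sum.swap) (simp add: matrix_matrix_mult_def)
    moreover have "(\<Sum>l\<in>UNIV. (\<Sum>k. ?a k $ i $ l) * (\<Sum>k. ?b k $ l $ j))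
        = (lie_exp x y ** lie_exp x z) $ i $ j"
      by (simp add: matrix_matrix_mult_def lie_exp_def
          entry[OF summable_lie_exp_term, THEN sums_unique, symmetric])
    ultimately show ?thesis
      using sums_unique2[OF entry[OF summable_lie_exp_term, of x "y ** z" i j]]
      by (simp add: lie_exp_def)
  qed
  then show ?thesis by (simp add: vec_eq_iff)
qed

lemma lie_exp_lie_bracket: "lie_exp x (lie_bracket y z) = lie_bracket (lie_exp x y) (lie_exp x z)"
proof -
  interpret Vector_Spaces.linear cmat_scale cmat_scale "lie_exp x" by (rule lie_exp_linear)
  show ?thesis by (simp add: lie_bracket_def diff lie_exp_matrix_mult)
qed

text \<open>The partial sums lie in \<open>L\<close>, and a subspace of a finite-dimensional space
  is closed.\<close>

lemma lie_exp_mem: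
  assumes L: "lie_subalgebra L G" and x: "x \<in> L" and y: "y \<in> L"
  shows "lie_exp x y \<in> L"
proof -
  have sub: "subspace L"
    using L by (simp add: lie_subalgebra_def subspace_if_cmat_subspace)
  have "lie_exp_term x y k \<in> L" for k
    using L x y sub
    by (induction k) (auto simp: lie_exp_term_Suc lie_subalgebra_def subspace_scale)
  then have "(\<Sum>k<n. lie_exp_term x y k) \<in> L" for n
    by (intro subspace_sum[OF sub])
  moreover have "(\<lambda>n. \<Sum>k<n. lie_exp_term x y k) \<longlonglongrightarrow> lie_exp x y"
    unfolding lie_exp_def by (rule summable_LIMSEQ[OF summable_lie_exp_term])
  ultimately show ?thesis
    by (rule closed_sequentially[OF closed_subspace[OF sub]])
qed

lemma lie_exp_0: "lie_exp 0 y = y"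
proof -
  have "lie_exp_term 0 y (Suc k) = 0" for k
    by (simp add: lie_exp_term_Suc lie_bracket.zero_left)
  then show ?thesis
    using suminf_split_head[OF summable_lie_exp_term, of 0 y] by (simp add: lie_exp_def)
qed

text \<open>On the unit ball the majorant is independent of \<open>x\<close>, so the Weierstrass
  M-test applies. Some neighbourhood of 0 is all that the open mapping argument requires.\<close>

lemma continuous_on_lie_exp: "continuous_on (ball 0 1) (\<lambda>x :: complex^'n^'n. lie_exp x y)"
proof -
  obtain K where K: "K > 0" "\<And>x y :: complex^'n^'n. norm (lie_bracket x y) \<le> norm x * norm y * K"
    using lie_bracket.pos_bounded by blast
  have "norm (lie_exp_term x y k) \<le> K ^ k / fact k * norm y" if "x \<in> ball 0 1" for x k
  proof -
    have "norm (lie_exp_term x y k) \<le> (K * norm x) ^ k / fact k * norm y"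
      using K by (intro norm_lie_exp_term_le) auto
    also have "\<dots> \<le> K ^ k / fact k * norm y"
      using that K by (intro mult_right_mono divide_right_mono power_mono) (auto simp: mult_le_cancel_left1)
    finally show ?thesis .
  qed
  moreover have "summable (\<lambda>k. K ^ k / fact k * norm y)"
    using summable_exp[of K] by (intro summable_mult2) (simp add: field_simps)
  ultimately have "uniform_limit (ball 0 1) (\<lambda>n x. \<Sum>k<n. lie_exp_term x y k)
      (\<lambda>x. lie_exp x y) sequentially"
    unfolding lie_exp_def by (rule Weierstrass_m_test)
  moreover have "continuous_on (ball 0 1) (\<lambda>x. lie_exp_term x y k)" for k
    by (induction k) (auto simp: lie_exp_term_Suc intro!: continuous_intros lie_bracket.continuous_on)
  ultimately show ?thesis
    by (intro uniform_limit_theorem[OF always_eventually]) (auto intro: continuous_intros)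
qed

text \<open>The first two terms of the series are \<open>y\<close> and
  \<open>lie_bracket x y\<close>; the remaining tail is quadratic in \<open>norm x\<close>.\<close>

lemma has_derivative_lie_exp:
  "((\<lambda>x. lie_exp x y) has_derivative (\<lambda>x. lie_bracket x y)) (at 0)"
proof -
  obtain K where K: "K > 0" "\<And>x y :: complex^'a^'a. norm (lie_bracket x y) \<le> norm x * norm y * K"
    using lie_bracket.pos_bounded by blast
  have bound: "norm (lie_exp x y - y - lie_bracket x y) \<le> K\<^sup>2 * norm y * (norm x)\<^sup>2 * exp (K * norm x)" for x
  proof -
    let ?u = "\<lambda>k. lie_exp_term x y (k + 2)"
    let ?c = "(K * norm x)\<^sup>2 * norm y"
    have "lie_exp x y - y - lie_bracket x y = (\<Sum>k. ?u k)"
      using suminf_split_initial_segment[OF summable_lie_exp_term, of x y 2]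
      by (simp add: lie_exp_def eval_nat_numeral lie_exp_term_Suc)
    also have "norm \<dots> \<le> (\<Sum>k. norm (?u k))"
      by (intro summable_norm summable_ignore_initial_segment summable_norm_lie_exp_term)
    also have "\<dots> \<le> (\<Sum>k. ?c * ((K * norm x) ^ k /\<^sub>R fact k))"
    proof (intro suminf_le)
      show "norm (?u k) \<le> ?c * ((K * norm x) ^ k /\<^sub>R fact k)" for k
      proof -
        have "norm (?u k) \<le> (K * norm x) ^ (k + 2) / fact (k + 2) * norm y"
          using K by (intro norm_lie_exp_term_le) auto
        \<comment> \<open>Weakening \<open>fact (k + 2)\<close> to \<open>fact k\<close> lets the
          tail sum to a full exponential times the square of \<open>K * norm x\<close>.\<close>
        also have "\<dots> \<le> (K * norm x) ^ (k + 2) / fact k * norm y"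
          using K by (intro mult_right_mono divide_left_mono fact_mono) auto
        finally show ?thesis by (simp add: power_add power2_eq_square field_simps)
      qed
      show "summable (\<lambda>k. norm (?u k))"
        by (intro summable_ignore_initial_segment summable_norm_lie_exp_term)
      show "summable (\<lambda>k. ?c * ((K * norm x) ^ k /\<^sub>R fact k))"
        by (intro summable_mult summable_exp_generic)
    qed
    also have "\<dots> = ?c * exp (K * norm x)"
      unfolding exp_def by (rule suminf_mult[OF summable_exp_generic])
    finally show ?thesis by (simp add: power_mult_distrib mult_ac)
  qed
  show ?thesis
    unfolding has_derivative_at2
  proof (intro conjI)
    show "bounded_linear (\<lambda>x. lie_bracket x y)"
      by (rule lie_bracket.bounded_linear_left)
    have "((\<lambda>x :: complex^'a^'a. K\<^sup>2 * norm y * norm x * exp (K * norm x)) \<longlongrightarrow> 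
        K\<^sup>2 * norm y * norm (0 :: complex^'a^'a) * exp (K * norm (0 :: complex^'a^'a))) (at 0)"
      by (intro tendsto_intros)
    then have lim: "((\<lambda>x :: complex^'a^'a. K\<^sup>2 * norm y * norm x * exp (K * norm x)) \<longlongrightarrow> 0) (at 0)"
      by simp
    show "((\<lambda>x. (1 / norm (x - 0)) *\<^sub>R (lie_exp x y - (lie_exp 0 y + lie_bracket (x - 0) y)))
        \<longlongrightarrow> 0) (at 0)"
    proof (rule Lim_null_comparison[OF _ lim], rule always_eventually, rule allI)
      fix x :: "complex^'a^'a"
      show "norm ((1 / norm (x - 0)) *\<^sub>R (lie_exp x y - (lie_exp 0 y + lie_bracket (x - 0) y)))
          \<le> K\<^sup>2 * norm y * norm x * exp (K * norm x)"
      proof (cases "x = 0")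
        case False
        have "norm ((1 / norm (x - 0)) *\<^sub>R (lie_exp x y - (lie_exp 0 y + lie_bracket (x - 0) y)))
            = norm (lie_exp x y - y - lie_bracket x y) / norm x"
          unfolding norm_scaleR by (simp add: lie_exp_0 diff_diff_eq)
        also have "\<dots> \<le> K\<^sup>2 * norm y * (norm x)\<^sup>2 * exp (K * norm x) / norm x"
          by (intro divide_right_mono bound) simp
        finally show ?thesis using False by (simp add: power2_eq_square)
      qed simp
    qed
  qed
qed

subsection \<open>Pencils of linear maps\<close>

text \<open>The determinant is holomorphic in \<open>t\<close> with value \<open>det A\<close> at 0.
  If it is constant it has no zeros; otherwise its zeros are countable.\<close>

lemma countable_singular_pencil:
  fixes A B :: "complex^'m^'m"
  assumes "det A \<noteq> 0"
  shows "countable {t. det (\<chi> i j. (1 - t) * A $ i $ j + t * B $ i $ j) = 0}"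
proof -
  define D where "D t = det (\<chi> i j. (1 - t) * A $ i $ j + t * B $ i $ j)" for t
  have hol: "D holomorphic_on UNIV"
    unfolding D_def[abs_def] det_def vec_lambda_beta by (intro holomorphic_intros)
  have "D 0 \<noteq> 0" using assms by (simp add: D_def)
  have "countable {t \<in> UNIV. D t = 0}"
  proof (cases "D constant_on UNIV")
    case True
    then obtain c where "D t = c" for t
      unfolding constant_on_def by blast
    then have "{t \<in> UNIV. D t = 0} = {}" using \<open>D 0 \<noteq> 0\<close> by auto
    then show ?thesis by simp
  next
    case False
    then show ?thesis
      by (intro holomorphic_countable_zeros[OF hol]) auto
  qed
  then show ?thesis by (simp add: D_def)
qed

lemma countable_noninjective_pencil:
  fixes S T :: "complex^'n^'n \<Rightarrow> complex^'n^'n"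
  assumes S: "Vector_Spaces.linear cmat_scale cmat_scale S"
    and T: "Vector_Spaces.linear cmat_scale cmat_scale T"
    and inj: "inj S"
  shows "countable {t. \<not> inj (\<lambda>x. (1 - t) *\<^sub>M S x + t *\<^sub>M T x)}"
proof -
  \<comment> \<open>Matrices are flattened to vectors indexed by pairs, so that an endomorphism of
    the matrix space has a matrix and a determinant.\<close>
  define flat :: "complex^'n^'n \<Rightarrow> complex^('n \<times> 'n)" where "flat x = (\<chi> p. x $ fst p $ snd p)" for x
  define unflat :: "complex^('n \<times> 'n) \<Rightarrow> complex^'n^'n" where "unflat v = (\<chi> i j. v $ (i, j))" for v
  define M where "M f = matrix (flat \<circ> f \<circ> unflat)" for f
  have inverse: "unflat (flat x) = x" "flat (unflat v) = v" for x v
    by (simp_all add: flat_def unflat_def vec_eq_iff)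
  have inj_iff: "inj (flat \<circ> f \<circ> unflat) \<longleftrightarrow> inj f" for f
  proof
    assume conj: "inj (flat \<circ> f \<circ> unflat)"
    show "inj f"
    proof (rule injI)
      fix x y assume "f x = f y"
      then have "flat x = flat y"
        by - (rule injD[OF conj], simp add: inverse)
      then show "x = y" by (metis inverse(1))
    qed
  next
    assume "inj f"
    moreover have "inj flat" "inj unflat"
      by (rule inj_on_inverseI, rule inverse)+
    ultimately show "inj (flat \<circ> f \<circ> unflat)" by (intro inj_compose)
  qed
  have det_iff: "det (M f) \<noteq> 0 \<longleftrightarrow> inj f" if f: "Vector_Spaces.linear cmat_scale cmat_scale f" for f
  proof -
    interpret f: Vector_Spaces.linear cmat_scale cmat_scale f by (rule f)
    have "flat (f (unflat (x + y))) = flat (f (unflat x)) + flat (f (unflat y))" for x y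
    proof -
      have "unflat (x + y) = unflat x + unflat y" by (simp add: unflat_def vec_eq_iff)
      then show ?thesis by (simp add: f.add) (simp add: flat_def vec_eq_iff)
    qed
    moreover have "flat (f (unflat (c *s x))) = c *s flat (f (unflat x))" for c x
    proof -
      have "unflat (c *s x) = c *\<^sub>M unflat x" by (simp add: unflat_def vec_eq_iff)
      then show ?thesis by (simp add: f.scale) (simp add: flat_def vec_eq_iff)
    qed
    ultimately have "Vector_Spaces.linear (*s) (*s) (flat \<circ> f \<circ> unflat)"
      by (simp add: Vector_Spaces.linear_iff vec.vector_space_axioms)
    then show ?thesis
      unfolding M_def inj_iff[symmetric] by (rule det_nz_iff_inj_gen)
  qed
  have lin: "Vector_Spaces.linear cmat_scale cmat_scale (\<lambda>x. (1 - t) *\<^sub>M S x + t *\<^sub>M T x)" for t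
  proof -
    interpret S: Vector_Spaces.linear cmat_scale cmat_scale S by (rule S)
    interpret T: Vector_Spaces.linear cmat_scale cmat_scale T by (rule T)
    show ?thesis
      by (simp add: Vector_Spaces.linear_iff cmat.vector_space_axioms S.add S.scale T.add T.scale)
        (simp add: vec_eq_iff algebra_simps)
  qed
  have M_eq: "M (\<lambda>x. (1 - t) *\<^sub>M S x + t *\<^sub>M T x) = (\<chi> i j. (1 - t) * M S $ i $ j + t * M T $ i $ j)" for t
    by (simp add: M_def matrix_def flat_def vec_eq_iff)
  have "det (M S) \<noteq> 0" using det_iff[OF S] inj by simp
  from countable_singular_pencil[OF this, of "M T"] show ?thesis
    unfolding det_iff[OF lin, symmetric] M_eq not_not .
qed

subsection \<open>Principal elements under automorphisms\<close>

lemma principal_element_props: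
  assumes "lie_subalgebra L G" "frobenius_functional L F"
  shows "principal_element L F \<in> L"
    and "x \<in> L \<Longrightarrow> F (lie_bracket (principal_element L F) x) = F x"
proof -
  have *: "principal_element L F \<in> L \<and> (\<forall>x\<in>L. F x = F (lie_bracket (principal_element L F) x))"
    unfolding principal_element_def by (rule theI'[OF principal_element_ex1[OF assms]])
  show "principal_element L F \<in> L" using * by (rule conjunct1)
  show "F (lie_bracket (principal_element L F) x) = F x" if "x \<in> L"
    using bspec[OF conjunct2[OF *] that] by (rule sym)
qed

lemma principal_element_eqI:
  assumes "lie_subalgebra L G" "frobenius_functional L F"
    and "h \<in> L" "\<And>x. x \<in> L \<Longrightarrow> F x = F (lie_bracket h x)"
  shows "principal_element L F = h"
  unfolding principal_element_def
  using the1_equality[OF principal_element_ex1[OF assms(1,2)]] assms(3,4) by blast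

lemma principal_element_cong:
  assumes "lie_subalgebra L G" "\<And>x. x \<in> L \<Longrightarrow> F x = F' x"
  shows "principal_element L F = principal_element L F'"
proof -
  have "(h \<in> L \<and> (\<forall>x\<in>L. F x = F (lie_bracket h x))) \<longleftrightarrow>
      (h \<in> L \<and> (\<forall>x\<in>L. F' x = F' (lie_bracket h x)))" for h
    using assms by (intro conj_cong ball_cong refl) (simp add: lie_subalgebra_def)
  then show ?thesis by (simp only: principal_element_def)
qed

lemma frobenius_functional_cong:
  assumes "lie_subalgebra L G" "\<And>x. x \<in> L \<Longrightarrow> F x = F' x"
  shows "frobenius_functional L F \<longleftrightarrow> frobenius_functional L F'"
proof -
  have "cmat.subspace L" using assms(1) by (simp add: lie_subalgebra_def)
  then have "dual_element L F \<longleftrightarrow> dual_element L F'"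
    using assms(2) by (simp add: dual_element_def cmat.subspace_add cmat.subspace_scale)
  moreover have "bracket_form F x y = bracket_form F' x y" if "x \<in> L" "y \<in> L" for x y
    using assms that by (simp add: bracket_form_def lie_subalgebra_def)
  ultimately show ?thesis by (auto simp: frobenius_functional_def)
qed

text \<open>The desired conclusion as a relation between elements; that it is symmetric and
  transitive is what the connectedness argument exploits.\<close>

definition ad_cospectral ::
    "(complex^'n^'n) set \<Rightarrow> complex^'n^'n \<Rightarrow> complex^'n^'n \<Rightarrow> bool"
  where "ad_cospectral L h k \<longleftrightarrow> ad_eigenvalues L h = ad_eigenvalues L k
    \<and> (\<forall>\<mu>. ad_multiplicity L h \<mu> = ad_multiplicity L k \<mu>)"

text \<open>\<open>\<phi>\<close> intertwines \<open>ad h - \<mu>\<close> with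
  \<open>ad (\<phi> h) - \<mu>\<close>, hence carries eigenvectors to eigenvectors and each
  generalized eigenspace isomorphically onto its counterpart.\<close>

lemma ad_cospectral_automorphism:
  assumes L: "lie_subalgebra L G" and h: "h \<in> L"
    and \<phi>: "Vector_Spaces.linear cmat_scale cmat_scale \<phi>"
    and hom: "\<And>x y. \<phi> (lie_bracket x y) = lie_bracket (\<phi> x) (\<phi> y)"
    and bij: "bij_betw \<phi> L L"
  shows "ad_cospectral L h (\<phi> h)"
proof -
  interpret \<phi>: Vector_Spaces.linear cmat_scale cmat_scale \<phi> by (rule \<phi>)
  interpret P: finite_dimensional_vector_space_pair cmat_scale "range matrix_unit"
      cmat_scale "range (matrix_unit :: 'a \<times> 'a \<Rightarrow> _)" ..
  have sub: "cmat.subspace L" using L by (simp add: lie_subalgebra_def)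
  have inj: "inj_on \<phi> L" and im: "\<phi> ` L = L"
    using bij by (auto simp: bij_betw_def)
  have zero: "\<phi> y = 0 \<longleftrightarrow> y = 0" if "y \<in> L" for y
    using inj_onD[OF inj, of y 0] that cmat.subspace_0[OF sub] by auto
  let ?T = "\<lambda>h \<mu> z. lie_bracket h z - \<mu> *\<^sub>M z"
  have step: "\<phi> (?T h \<mu> z) = ?T (\<phi> h) \<mu> (\<phi> z)" for \<mu> z
    by (simp add: \<phi>.diff \<phi>.scale hom)
  have iter: "\<phi> ((?T h \<mu> ^^ k) z) = (?T (\<phi> h) \<mu> ^^ k) (\<phi> z)" for \<mu> z k
    by (induction k) (simp_all add: step)
  have T_mem: "?T h \<mu> z \<in> L" if "z \<in> L" for \<mu> z
    using that L h by (auto simp: lie_subalgebra_def intro: cmat.subspace_diff cmat.subspace_scale)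
  have iter_mem: "(?T h \<mu> ^^ k) z \<in> L" if "z \<in> L" for \<mu> z k
    using that by (induction k) (auto intro: T_mem)
  have "ad_eigenvalues L h = ad_eigenvalues L (\<phi> h)"
  proof -
    have "lie_bracket (\<phi> h) (\<phi> y) = \<mu> *\<^sub>M \<phi> y \<longleftrightarrow> lie_bracket h y = \<mu> *\<^sub>M y" if "y \<in> L" for \<mu> y
      using zero[OF T_mem[OF that], of \<mu>] by (simp add: step)
    moreover have "ad_eigenvalues L (\<phi> h) = {\<mu>. \<exists>y\<in>\<phi> ` L. y \<noteq> 0 \<and> lie_bracket (\<phi> h) y = \<mu> *\<^sub>M y}"
      by (simp add: ad_eigenvalues_def im)
    ultimately show ?thesis by (simp add: ad_eigenvalues_def zero cong: bex_cong)
  qed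
  moreover have "ad_multiplicity L h \<mu> = ad_multiplicity L (\<phi> h) \<mu>" for \<mu>
  proof -
    let ?E = "ad_generalized_eigenspace L h \<mu>"
    have "ad_generalized_eigenspace L (\<phi> h) \<mu> = {y \<in> \<phi> ` L. \<exists>k. (?T (\<phi> h) \<mu> ^^ k) y = 0}"
      by (simp add: ad_generalized_eigenspace_def im)
    also have "\<dots> = \<phi> ` ?E"
      by (auto simp: ad_generalized_eigenspace_def iter[symmetric] zero iter_mem intro!: imageI)
    finally have "ad_multiplicity L (\<phi> h) \<mu> = cmat.dim (\<phi> ` ?E)"
      by (simp add: ad_multiplicity_def)
    also have "\<dots> = cmat.dim ?E"
    proof (rule P.dim_image_eq[OF \<phi>])
      have "cmat.span ?E \<subseteq> L"
        by (rule cmat.span_minimal[OF _ sub]) (auto simp: ad_generalized_eigenspace_def)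
      then show "inj_on \<phi> (cmat.span ?E)" by (rule inj_on_subset[OF inj])
    qed
    finally show ?thesis by (simp add: ad_multiplicity_def)
  qed
  ultimately show ?thesis by (simp add: ad_cospectral_def)
qed

text \<open>Bijectivity of \<open>\<phi>\<close> on \<open>L\<close> comes for free: injectivity
  from non-degeneracy of \<open>F'\<close>, surjectivity by dimension. Then \<open>\<phi>\<close>
  maps the principal element of \<open>F'\<close> to that of \<open>F\<close>.\<close>

lemma ad_cospectral_principal_element_pullback:
  assumes L: "lie_subalgebra L G" and F: "frobenius_functional L F"
    and F': "frobenius_functional L F'"
    and \<phi>: "Vector_Spaces.linear cmat_scale cmat_scale \<phi>" "\<phi> ` L \<subseteq> L"
    and hom: "\<And>x y. \<phi> (lie_bracket x y) = lie_bracket (\<phi> x) (\<phi> y)"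
    and eq: "\<And>y. y \<in> L \<Longrightarrow> F' y = F (\<phi> y)"
  shows "ad_cospectral L (principal_element L F') (principal_element L F)"
proof -
  interpret \<phi>: Vector_Spaces.linear cmat_scale cmat_scale \<phi> by (rule \<phi>)
  interpret P: finite_dimensional_vector_space_pair cmat_scale "range matrix_unit"
      cmat_scale "range (matrix_unit :: 'a \<times> 'a \<Rightarrow> _)" ..
  have sub: "cmat.subspace L" and br: "\<And>x y. x \<in> L \<Longrightarrow> y \<in> L \<Longrightarrow> lie_bracket x y \<in> L"
    using L by (auto simp: lie_subalgebra_def)
  have F0: "F 0 = 0"
    using F cmat.subspace_0[OF sub] unfolding frobenius_functional_def dual_element_def
    by (metis cmat.scale_zero_left mult_zero_left)
  \<comment> \<open>The kernel of \<open>\<phi>\<close> lies in the radical of the form of \<open>F'\<close>.\<close>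
  have inj: "inj_on \<phi> L"
    unfolding \<phi>.inj_on_iff_eq_0[OF sub]
  proof (intro ballI impI)
    fix x assume x: "x \<in> L" "\<phi> x = 0"
    have "F' (lie_bracket x y) = 0" if "y \<in> L" for y
      using x that by (simp add: eq br hom lie_bracket.zero_left F0)
    then show "x = 0"
      using F' x by (auto simp: frobenius_functional_def bracket_form_def)
  qed
  have "cmat.dim (\<phi> ` L) = cmat.dim L"
    using P.dim_image_eq[OF \<phi>(1)] inj by (simp add: cmat.span_eq_iff[THEN iffD2, OF sub])
  then have im: "\<phi> ` L = L"
    using cmat.subspace_dim_equal[OF \<phi>.subspace_image[OF sub] sub \<phi>(2)] by simp
  let ?h = "principal_element L F'"
  have h: "?h \<in> L" "\<And>x. x \<in> L \<Longrightarrow> F' (lie_bracket ?h x) = F' x"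
    using principal_element_props[OF L F'] by auto
  \<comment> \<open>For \<open>x = \<phi> y\<close>, both sides pull back to the defining equation
    of \<open>?h\<close> for \<open>F'\<close> at \<open>y\<close>.\<close>
  have "principal_element L F = \<phi> ?h"
  proof (rule principal_element_eqI[OF L F])
    show "\<phi> ?h \<in> L" using h(1) \<phi>(2) by auto
    fix x assume "x \<in> L"
    then obtain y where y: "y \<in> L" "x = \<phi> y" using im by auto
    then show "F x = F (lie_bracket (\<phi> ?h) x)"
      using h br by (simp add: hom[symmetric] eq[symmetric])
  qed
  then show ?thesis
    using ad_cospectral_automorphism[OF L h(1) \<phi>(1) hom] inj im by (simp add: bij_betw_def)
qed

subsection \<open>The coadjoint orbit of a Frobenius functional\<close>

abbreviation linear_functional :: "(complex^'n^'n \<Rightarrow> complex) \<Rightarrow> bool"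
  where "linear_functional F \<equiv> Vector_Spaces.linear cmat_scale (*) F"

lemma vector_space_complex_mult: "vector_space ((*) :: complex \<Rightarrow> complex \<Rightarrow> complex)"
  by unfold_locales (simp_all add: algebra_simps)

lemma linear_functional_iff:
  "linear_functional F \<longleftrightarrow> (\<forall>x y. F (x + y) = F x + F y) \<and> (\<forall>c x. F (c *\<^sub>M x) = c * F x)"
  by (simp add: Vector_Spaces.linear_iff cmat.vector_space_axioms vector_space_complex_mult)

lemma linear_functional_bounded_linear: "linear_functional F \<Longrightarrow> bounded_linear F"
  by (rule bounded_linear_if_additive_homogeneous)
    (simp_all add: linear_functional_iff scaleR_conv_of_real)

lemma cmat_linear_bounded_linear:
  assumes "Vector_Spaces.linear cmat_scale cmat_scale f"
  shows "bounded_linear f"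
  using assms by (intro bounded_linear_if_additive_homogeneous)
    (simp_all add: Vector_Spaces.linear_iff scaleR_eq_cmat_scale)

lemma bounded_linear_cmat_scale_left: "bounded_linear (\<lambda>c. c *\<^sub>M (b :: complex^'n^'n))"
  by (auto simp: linear_conv_bounded_linear[symmetric] vec_eq_iff algebra_simps intro!: linearI)

text \<open>The basis \<open>B\<close> provides coordinates on the dual of \<open>L\<close>; the
  projection \<open>P\<close> extends functionals and maps from \<open>L\<close> to the whole matrix
  space.\<close>

locale lie_subalgebra_with_projection =
  fixes L B :: "(complex^'n^'n) set" and P :: "complex^'n^'n \<Rightarrow> complex^'n^'n"
  assumes lie_subalgebra: "lie_subalgebra L sl"
    and basis: "cmat.independent B" "cmat.span B = L"
    and proj_linear: "Vector_Spaces.linear cmat_scale cmat_scale P"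
    and proj_mem: "P x \<in> L" and proj_id: "x \<in> L \<Longrightarrow> P x = x"
begin

sublocale proj: Vector_Spaces.linear cmat_scale cmat_scale P
  by (rule proj_linear)

lemma subspace_L: "cmat.subspace L"
  and bracket_mem: "x \<in> L \<Longrightarrow> y \<in> L \<Longrightarrow> lie_bracket x y \<in> L"
  using lie_subalgebra by (auto simp: lie_subalgebra_def)

lemma B_subset: "B \<subseteq> L" and finite_B: "finite B"
  using basis cmat.span_superset cmat.finiteI_independent by blast+

definition coords :: "(complex^'n^'n \<Rightarrow> complex) \<Rightarrow> complex^'n^'n"
  where "coords F = (\<Sum>b\<in>B. F b *\<^sub>M b)"

lemma coords_mem: "coords F \<in> L"
  unfolding coords_def basis(2)[symmetric]
  by (intro cmat.span_sum cmat.span_scale cmat.span_base)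

lemma coords_cong: "(\<And>x. x \<in> L \<Longrightarrow> F x = F' x) \<Longrightarrow> coords F = coords F'"
  using B_subset by (auto simp: coords_def intro!: sum.cong)

lemma coords_eqD:
  assumes "dual_element L F" "dual_element L F'" "coords F = coords F'" "x \<in> L"
  shows "F x = F' x"
proof (rule dual_element_eqI[OF subspace_L B_subset _ assms(1,2) _ assms(4)])
  show "L \<subseteq> cmat.span B" using basis(2) by simp
  have "(\<Sum>b\<in>B. (F b - F' b) *\<^sub>M b) = 0"
    using assms(3) by (simp add: coords_def cmat.scale_left_diff_distrib sum_subtractf)
  then show "F b = F' b" if "b \<in> B" for b
    using cmat.independentD[OF basis(1) finite_B subset_refl, of "\<lambda>b. F b - F' b"] that by simp
qed

text \<open>\<open>coords\<close> identifies the dual of \<open>L\<close> with \<open>L\<close>. The complement \<open>x - P x\<close> is added in \<open>form_map\<close> because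
  the open mapping theorem used below wants a map onto a whole Euclidean space; \<open>form_map F\<close> is
  the derivative at \<open>0\<close> of \<open>x \<mapsto> coords (F \<circ> lie_exp (P x)) + (x - P x)\<close>.\<close>

definition form_map :: "(complex^'n^'n \<Rightarrow> complex) \<Rightarrow> complex^'n^'n \<Rightarrow> complex^'n^'n"
  where "form_map F x = coords (bracket_form F (P x)) + (x - P x)"

lemma form_map_linear:
  assumes "linear_functional F"
  shows "Vector_Spaces.linear cmat_scale cmat_scale (form_map F)"
  using assms
  by (simp add: Vector_Spaces.linear_iff[of cmat_scale cmat_scale] cmat.vector_space_axioms form_map_def coords_def
      bracket_form_def linear_functional_iff proj.add proj.scale lie_bracket_add_left
      lie_bracket_scale_left cmat.scale_left_distrib sum.distrib cmat.scale_right_distrib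
      cmat.scale_sum_right cmat.scale_right_diff_distrib)

text \<open>\<open>P\<close> kills \<open>x - P x\<close> but fixes every element of
  \<open>L\<close>, so an \<open>x - P x\<close> in \<open>L\<close> is 0.\<close>

lemma proj_complement_mem: "x - P x \<in> L \<Longrightarrow> P x = x"
  using proj_id[of "x - P x"] proj_id[OF proj_mem, of x] by (simp add: proj.diff)

lemma dual_element_linear_functional: "linear_functional F \<Longrightarrow> dual_element L F"
  by (simp add: dual_element_def linear_functional_iff)

text \<open>The kernel of \<open>form_map F\<close> is exactly the radical of the bracket form on
  \<open>L\<close>, since the summand \<open>x - P x\<close> excludes anything outside
  \<open>L\<close>.\<close>

lemma inj_form_map_iff:
  assumes F: "linear_functional F"
  shows "inj (form_map F) \<longleftrightarrow> frobenius_functional L F"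
proof -
  interpret T: Vector_Spaces.linear cmat_scale cmat_scale "form_map F"
    by (rule form_map_linear[OF F])
  have "form_map F x = 0 \<longleftrightarrow> x \<in> L \<and> (\<forall>y\<in>L. bracket_form F x y = 0)" for x
  proof
    assume zero: "form_map F x = 0"
    then have "x - P x = - coords (bracket_form F (P x))"
      by (simp add: form_map_def eq_neg_iff_add_eq_0 add.commute)
    then have "x - P x \<in> L"
      using cmat.subspace_neg[OF subspace_L coords_mem] by simp
    then have Px: "P x = x" by (rule proj_complement_mem)
    \<comment> \<open>Zero is written as the coordinates of the zero functional so that
      \<open>coords_eqD\<close> can compare two functionals.\<close>
    then have "coords (bracket_form F x) = coords (\<lambda>_. 0)"
      using zero by (simp add: form_map_def) (simp add: coords_def)
    moreover have "dual_element L (bracket_form F x)" "dual_element L (\<lambda>_. 0)"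
      using F by (simp_all add: dual_element_def bracket_form_def linear_functional_iff
          lie_bracket_add_right lie_bracket_scale_right)
    ultimately have "\<forall>y\<in>L. bracket_form F x y = 0"
      using coords_eqD by blast
    then show "x \<in> L \<and> (\<forall>y\<in>L. bracket_form F x y = 0)"
      using proj_mem[of x] Px by simp
  next
    assume x: "x \<in> L \<and> (\<forall>y\<in>L. bracket_form F x y = 0)"
    then have "coords (bracket_form F x) = coords (\<lambda>_. 0)"
      by (intro coords_cong) simp
    then show "form_map F x = 0"
      using x by (simp add: form_map_def proj_id) (simp add: coords_def)
  qed
  then show ?thesis
    using dual_element_linear_functional[OF F]
    by (auto simp: T.inj_iff_eq_0 frobenius_functional_def)
qed

text \<open>Non-degeneracy makes the derivative of the orbit map at 0 invertible, so the open
  mapping theorem puts a neighbourhood of \<open>coords F\<close> into its image.\<close>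

lemma orbit_neighbourhood:
  assumes F: "linear_functional F" and frob: "frobenius_functional L F"
  obtains U where "open U" "coords F \<in> U"
    "\<And>F'. linear_functional F' \<Longrightarrow> coords F' \<in> U \<Longrightarrow> \<exists>x\<in>L. \<forall>y\<in>L. F' y = F (lie_exp x y)"
proof
  let ?\<Phi> = "\<lambda>x. coords (\<lambda>y. F (lie_exp (P x) y)) + (x - P x)"
  \<comment> \<open>The domain on which \<open>lie_exp (P x)\<close> is known to be continuous in
    \<open>x\<close>.\<close>
  let ?S = "P -` ball 0 1"
  interpret pair: finite_dimensional_vector_space_pair cmat_scale "range matrix_unit"
      cmat_scale "range (matrix_unit :: 'n \<times> 'n \<Rightarrow> _)" ..
  note P = cmat_linear_bounded_linear[OF proj_linear]
  note Fb = linear_functional_bounded_linear[OF F]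
  have contP: "continuous_on X P" for X
    by (rule bounded_linear.continuous_on[OF P continuous_on_id])
  have "open ?S" by (rule open_vimage[OF open_ball contP])
  have cont: "continuous_on ?S ?\<Phi>"
  proof -
    have "continuous_on ?S (\<lambda>x. lie_exp (P x) y)" for y
      using continuous_on_compose[OF contP continuous_on_subset[OF continuous_on_lie_exp]]
      by (fastforce simp: o_def)
    then show ?thesis
      unfolding coords_def
      by (intro continuous_intros contP bounded_linear.continuous_on[OF bounded_linear_cmat_scale_left]
          bounded_linear.continuous_on[OF Fb])
  qed
  have deriv: "(?\<Phi> has_derivative form_map F) (at 0)"
  proof -
    have "((\<lambda>x. lie_exp (P x) y) has_derivative (\<lambda>x. lie_bracket (P x) y)) (at 0)" for y
    proof -
      have "(P has_derivative P) (at 0)" by (rule bounded_linear_imp_has_derivative[OF P])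
      moreover have "((\<lambda>x. lie_exp x y) has_derivative (\<lambda>x. lie_bracket x y)) (at (P 0))"
        by (simp add: proj.zero has_derivative_lie_exp)
      ultimately show ?thesis by (rule has_derivative_compose)
    qed
    then have "((\<lambda>x. F (lie_exp (P x) b) *\<^sub>M b) has_derivative (\<lambda>x. F (lie_bracket (P x) b) *\<^sub>M b)) (at 0)" for b
      by (intro bounded_linear.has_derivative[OF bounded_linear_cmat_scale_left]
          bounded_linear.has_derivative[OF Fb])
    then show ?thesis
      unfolding form_map_def[abs_def] coords_def bracket_form_def
      by (intro has_derivative_add has_derivative_sum has_derivative_diff has_derivative_ident
          bounded_linear_imp_has_derivative[OF P])
  qed
  have "inj (form_map F)" using inj_form_map_iff[OF F] frob by simp
  \<comment> \<open>The open mapping theorem takes a bounded right inverse of the derivative; in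
    finite dimension injectivity supplies one.\<close>
  then obtain g where g: "Vector_Spaces.linear cmat_scale cmat_scale g" "form_map F \<circ> g = id"
    using pair.linear_surjective_right_inverse[OF form_map_linear[OF F]]
      cmat.linear_inj_imp_surj[OF form_map_linear[OF F]] by blast
  let ?U = "interior (?\<Phi> ` ?S)"
  show "open ?U" by simp
  have "?\<Phi> 0 = coords F" by (simp add: proj.zero lie_exp_0)
  moreover have "?\<Phi> 0 \<in> ?U"
    by (rule sussmann_open_mapping[OF \<open>open ?S\<close> cont _ deriv cmat_linear_bounded_linear[OF g(1)] g(2)])
      (use \<open>open ?S\<close> in \<open>simp_all add: proj.zero interior_open\<close>)
  ultimately show "coords F \<in> ?U" by simp
  fix F' assume F': "linear_functional F'" and "coords F' \<in> ?U"
  then obtain x where x: "coords F' = ?\<Phi> x"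
    using interior_subset by blast
  \<comment> \<open>A preimage might have a component outside \<open>L\<close>. Since both
    coordinate vectors lie in \<open>L\<close>, that component vanishes and \<open>x\<close> is in
    \<open>L\<close>.\<close>
  then have "x - P x = coords F' - coords (\<lambda>y. F (lie_exp (P x) y))" by simp
  then have "x - P x \<in> L"
    using cmat.subspace_diff[OF subspace_L coords_mem coords_mem] by simp
  then have "P x = x" by (rule proj_complement_mem)
  with x have eq: "coords F' = coords (\<lambda>y. F (lie_exp x y))" by simp
  interpret E: Vector_Spaces.linear cmat_scale cmat_scale "lie_exp x" by (rule lie_exp_linear)
  have "dual_element L (\<lambda>y. F (lie_exp x y))"
    using F by (simp add: dual_element_def E.add E.scale linear_functional_iff)
  from coords_eqD[OF dual_element_linear_functional[OF F'] this eq]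
  show "\<exists>x\<in>L. \<forall>y\<in>L. F' y = F (lie_exp x y)"
    using proj_mem[of x] \<open>P x = x\<close> by auto
qed

lemma ad_cospectral_principal_elements:
  assumes F: "linear_functional F" "frobenius_functional L F"
    and F': "linear_functional F'" "frobenius_functional L F'"
  shows "ad_cospectral L (principal_element L F) (principal_element L F')"
proof -
  define H where "H t x = (1 - t) * F x + t * F' x" for t x
  let ?S = "{t. frobenius_functional L (H t)}"
  have H: "linear_functional (H t)" for t
    using F(1) F'(1) by (simp add: H_def linear_functional_iff algebra_simps)
  \<comment> \<open>Linearity is needed in the functional only up to affine combinations: the
    complement part has total weight \<open>(1 - t) + t = 1\<close>.\<close>
  have "form_map (H t) = (\<lambda>x. (1 - t) *\<^sub>M form_map F x + t *\<^sub>M form_map F' x)" for t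
  proof
    fix x
    have "bracket_form (H t) (P x) b *\<^sub>M b = (1 - t) *\<^sub>M bracket_form F (P x) b *\<^sub>M b
        + t *\<^sub>M bracket_form F' (P x) b *\<^sub>M b" for b
      by (simp add: bracket_form_def H_def cmat.scale_left_distrib)
    then have "coords (bracket_form (H t) (P x)) = (1 - t) *\<^sub>M coords (bracket_form F (P x))
        + t *\<^sub>M coords (bracket_form F' (P x))"
      by (simp add: coords_def sum.distrib cmat.scale_sum_right)
    then show "form_map (H t) x = (1 - t) *\<^sub>M form_map F x + t *\<^sub>M form_map F' x"
      by (simp add: form_map_def vec_eq_iff algebra_simps)
  qed
  then have "?S = - {t. \<not> inj (\<lambda>x. (1 - t) *\<^sub>M form_map F x + t *\<^sub>M form_map F' x)}"
    using inj_form_map_iff[OF H] by auto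
  moreover have "countable {t. \<not> inj (\<lambda>x. (1 - t) *\<^sub>M form_map F x + t *\<^sub>M form_map F' x)}"
    using inj_form_map_iff[OF F(1)] F(2)
    by (intro countable_noninjective_pencil form_map_linear F(1) F'(1)) simp
  \<comment> \<open>The complement of a countable set in the plane is path connected; the complex
    parameter \<open>t\<close> supplies the two real dimensions.\<close>
  ultimately have conn: "connected ?S"
    by (simp only: path_connected_imp_connected path_connected_complement_countable DIM_complex order_refl)
  have "H 0 = F" "H 1 = F'" by (auto simp: H_def)
  have "ad_cospectral L (principal_element L (H 0)) (principal_element L (H 1))"
  proof (rule connected_equivalence_relation[OF conn,
        where R = "\<lambda>s t. ad_cospectral L (principal_element L (H s)) (principal_element L (H t))"])
    show "0 \<in> ?S" "1 \<in> ?S"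
      using F F' \<open>H 0 = F\<close> \<open>H 1 = F'\<close> by simp_all
    fix s assume s: "s \<in> ?S"
    obtain U where U: "open U" "coords (H s) \<in> U"
      "\<And>F'. linear_functional F' \<Longrightarrow> coords F' \<in> U \<Longrightarrow> \<exists>x\<in>L. \<forall>y\<in>L. F' y = H s (lie_exp x y)"
      using orbit_neighbourhood[OF H] s by blast
    have "continuous_on UNIV (\<lambda>t. coords (H t))"
      unfolding coords_def H_def
      by (intro continuous_intros bounded_linear.continuous_on[OF bounded_linear_cmat_scale_left])
    then have "open ((\<lambda>t. coords (H t)) -` U)"
      using U(1) by (rule open_vimage[rotated])
    then have "openin (top_of_set ?S) (?S \<inter> (\<lambda>t. coords (H t)) -` U)"
      by (rule openin_open_Int)
    moreover have "ad_cospectral L (principal_element L (H s)) (principal_element L (H t))"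
      if t: "t \<in> ?S" "coords (H t) \<in> U" for t
    proof -
      obtain x where "x \<in> L" "\<And>y. y \<in> L \<Longrightarrow> H t y = H s (lie_exp x y)"
        using U(3)[OF H t(2)] by blast
      \<comment> \<open>On \<open>L\<close>, \<open>H t\<close> is the pullback of
        \<open>H s\<close> along the automorphism \<open>lie_exp x\<close>.\<close>
      then have "ad_cospectral L (principal_element L (H t)) (principal_element L (H s))"
        using s t lie_exp_mem[OF lie_subalgebra]
        by (intro ad_cospectral_principal_element_pullback[OF lie_subalgebra _ _ lie_exp_linear[of x]])
          (auto simp: lie_exp_lie_bracket)
      then show ?thesis by (simp add: ad_cospectral_def)
    qed
    ultimately show "\<exists>T. openin (top_of_set ?S) T \<and> s \<in> T \<and>
        (\<forall>t\<in>T. ad_cospectral L (principal_element L (H s)) (principal_element L (H t)))"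
      using s U(2) by (intro exI[of _ "?S \<inter> (\<lambda>t. coords (H t)) -` U"]) auto
  \<comment> \<open>What remains is symmetry and transitivity of the relation.\<close>
  qed (simp_all add: ad_cospectral_def)
  then show ?thesis by (simp only: \<open>H 0 = F\<close> \<open>H 1 = F'\<close>)
qed

text \<open>Replaces a functional, whose values outside \<open>L\<close> are arbitrary, by a globally linear one.\<close>

lemma linear_functional_proj:
  assumes "dual_element L F"
  shows "linear_functional (F \<circ> P)"
  using assms by (simp add: linear_functional_iff dual_element_def proj.add proj.scale proj_mem)

end

theorem theorem3:
  fixes \<ff> :: "(complex^'n^'n) set" and F F' :: "complex^'n^'n \<Rightarrow> complex"
  assumes "CARD('n) \<ge> 2"
    and "lie_subalgebra \<ff> sl"
    and "frobenius \<ff>"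
    and "saturated \<ff> sl"
    and "frobenius_functional \<ff> F"
    and "frobenius_functional \<ff> F'"
  shows "ad_eigenvalues \<ff> (principal_element \<ff> F) = ad_eigenvalues \<ff> (principal_element \<ff> F')
    \<and> (\<forall>\<mu>. ad_multiplicity \<ff> (principal_element \<ff> F) \<mu>
          = ad_multiplicity \<ff> (principal_element \<ff> F') \<mu>)"
proof -
  interpret pair: finite_dimensional_vector_space_pair cmat_scale "range matrix_unit"
      cmat_scale "range (matrix_unit :: 'n \<times> 'n \<Rightarrow> _)" ..
  have sub: "cmat.subspace \<ff>" using assms(2) by (simp add: lie_subalgebra_def)
  obtain B where B: "B \<subseteq> \<ff>" "cmat.independent B" "\<ff> \<subseteq> cmat.span B"
    using cmat.basis_exists by metis
  \<comment> \<open>A linear left inverse of the identity on \<open>\<ff>\<close> with range in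
    \<open>\<ff>\<close> is a projection onto \<open>\<ff>\<close>.\<close>
  obtain P where P: "range P \<subseteq> \<ff>" "Vector_Spaces.linear cmat_scale cmat_scale P" "\<And>v. v \<in> \<ff> \<Longrightarrow> P v = v"
    using pair.linear_exists_left_inverse_on[OF cmat.linear_id sub] by auto
  interpret lie_subalgebra_with_projection \<ff> B P
    using assms(2) B P cmat.span_minimal[OF B(1) sub]
    by unfold_locales (auto simp: Vector_Spaces.linear_iff)
  have principal: "principal_element \<ff> G = principal_element \<ff> (G \<circ> P)" for G
    by (rule principal_element_cong[OF assms(2)]) (simp add: proj_id)
  have "frobenius_functional \<ff> (G \<circ> P)" "linear_functional (G \<circ> P)" if "frobenius_functional \<ff> G" for G
    using that frobenius_functional_cong[OF assms(2), of G "G \<circ> P"]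
    by (auto simp: proj_id frobenius_functional_def intro: linear_functional_proj)
  then have "ad_cospectral \<ff> (principal_element \<ff> (F \<circ> P)) (principal_element \<ff> (F' \<circ> P))"
    using assms(5,6) by (intro ad_cospectral_principal_elements)
  then show ?thesis
    by (simp add: ad_cospectral_def principal[symmetric])
qed

end
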